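(* Let $r_1,r_2,r_3,r_4,r_5\in\mathbb{Z}$. Then $$S(r_1,r_2,r_3;r_4,r_5)+\frac{r_5}{g_1}S(r_1',r_2',-r_3;r_5,g_1)=A,$$ where $$g_1=\Big\{\frac{r_4}{r_5}\Big\}r_5,\qquad r_1'=\Big[\frac{r_3+g_1r_1}{r_5}\Big]+2,\qquad r_2'=\Big[\frac{r_3+g_1r_2}{r_5}\Big]-1,$$ $$\begin{aligned}A={}&(r_2-r_1+1)r_3+\frac{g_1}{2}(r_2+r_1)(r_2-r_1+1)\\&-r_5\Bigg(-\Big[\frac{(r_1'-1)r_5-r_3}{g_1}\Big]+(r_1'-2)(-r_1+1)+q-\Big[\frac{(r_2'+1)r_5-r_3}{g_1}\Big]+(r_2'+1)r_2\\&\qquad+\frac{r_3}{g_1}(r_2'-r_1'+1)-\frac{r_5}{2g_1}(r_2'+r_1')(r_2'-r_1'+1)\Bigg),\end{aligned}$$ $$q=\begin{cases}0, & \gcd(r_5,g_1)\nmid r_3,\\[1mm] \Bigg[\dfrac{r_2'-r_1'+2-r}{\frac{g_1}{\gcd(r_5,g_1)}}\Bigg]+1, & \gcd(r_5,g_1)\mid r_3,\end{cases}$$ $$r=\left\{\frac{\Big(\frac{r_3}{\gcd(r_5,g_1)}-(r_1'-1)\frac{r_5}{\gcd(r_5,g_1)}\Big)\Big(\frac{r_5}{\gcd(r_5,g_1)}\Big)^{-1}}{\frac{g_1}{\gcd(r_5,g_1)}}\right\}\frac{g_1}{\gcd(r_5,g_1)},$$ in which $\big(\frac{r_5}{\gcd(r_5,g_1)}\big)^{-1}\in\mathbb{Z}$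 and $\big(\frac{r_5}{\gcd(r_5,g_1)}\big)^{-1}\frac{r_5}{\gcd(r_5,g_1)}\equiv 1\pmod{\frac{g_1}{\gcd(r_5,g_1)}}$.
   Context: For a rational number $y$, $[y]$ is the floor (greatest integer $\le y$) and $\{y\}=y-[y]$ is the fractional part. For integers $s_1,s_2,s_3,s_4,s_5$, the fractional part sum $S$ is defined by $$S(s_1,s_2,s_3;s_4,s_5)=\sum_{x=s_1}^{s_2}\Big\{\frac{s_3+s_4x}{s_5}\Big\}s_5.$$
   Formalization: Assumes r_5 and g_1 nonzero; sums with reversed limits are read as minus the sum over the gap (as 0 the identity fails at (0,0,0,2,3)); the gcd takes the sign of r_5, since with a positive gcd the identity fails for r_5<0, e.g. (-4,0,-7,-6,-7). *)

theory Defs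
  imports "HOL-Number_Theory.Number_Theory"
begin

text \<open>
  Summation over consecutive integers with arbitrary integer limits. Reversed limits follow the
  usual telescoping convention, so that
  \<open>int_sum f a b + int_sum f (b + 1) c = int_sum f a c\<close> holds for all \<open>a\<close>, \<open>b\<close>, \<open>c\<close>.
  With \<open>a \<le> b + 1\<close> this is the ordinary sum (empty for \<open>a = b + 1\<close>).
\<close>
definition int_sum :: "(int \<Rightarrow> rat) \<Rightarrow> int \<Rightarrow> int \<Rightarrow> rat" where
  "int_sum f a b = (if a \<le> b then (\<Sum>x = a..b. f x) else - (\<Sum>x = b + 1..a - 1. f x))"

definition frac_sum :: "int \<Rightarrow> int \<Rightarrow> int \<Rightarrow> int \<Rightarrow> int \<Rightarrow> rat" where
  "frac_sum s1 s2 s3 s4 s5 =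
     int_sum (\<lambda>x. frac (of_int (s3 + s4 * x) / of_int s5) * of_int s5) s1 s2"

text \<open>
  A greatest common divisor of integers is determined up to sign. It is taken here with the sign
  of the first argument, so that for \<open>a > 0\<close> it is the usual positive one. For \<open>b = {c / a} a\<close>,
  which is either 0 or of the same sign as \<open>a\<close>, the quotient of \<open>b\<close> by it is then nonnegative also
  when \<open>a < 0\<close>; this matters for integer parts of fractions having that quotient as denominator.
\<close>
definition signed_gcd :: "int \<Rightarrow> int \<Rightarrow> int" where
  "signed_gcd a b = sgn a * gcd a b"

lemma signed_gcd_pos: "a > 0 \<Longrightarrow> signed_gcd a b = gcd a b"
  by (simp add: signed_gcd_def)

text \<open>The quantity \<open>{a / b} b\<close> is an integer, so an integer variable can be equated with it.\<close>
lemma frac_mult_denominator_eq_mod: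
  fixes a b :: int
  assumes "b \<noteq> 0"
  shows "frac (of_int a / of_int b :: rat) * of_int b = of_int (a mod b)"
proof -
  have "frac (of_int a / of_int b :: rat) * of_int b = of_int a - of_int (a div b) * of_int b"
    using assms by (simp add: frac_def floor_divide_of_int_eq left_diff_distrib)
  also have "\<dots> = of_int (a - a div b * b)"
    by simp
  also have "\<dots> = of_int (a mod b)"
    by (simp add: minus_div_mult_eq_mod)
  finally show ?thesis .
qed

end

theory Submission
  imports Defs
begin

text \<open>
  Write \<open>a x = \<lfloor>(r3 + g1 x) / r5\<rfloor>\<close> and \<open>b y = \<lfloor>(r5 y - r3) / g1\<rfloor>\<close>. As \<open>0 < g1 / r5 < 1\<close>, the value
  of \<open>a\<close> grows by 0 or 1 in each step, and where it jumps from \<open>y - 1 = a x\<close> to \<open>y = a (x + 1)\<close> the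
  value \<open>b y\<close> is \<open>x\<close>, or \<open>x + 1\<close> exactly when \<open>g1\<close> divides \<open>r5 y - r3\<close>. Hence summation by parts
  expresses the sum of \<open>a\<close> through the sum of \<open>b\<close>, up to the number of such exceptional \<open>y\<close>, which
  is \<open>q\<close>. All sums are evaluated by telescoping, which covers reversed limits at no extra cost.
\<close>

section \<open>Sums with arbitrary integer limits\<close>

lemma int_sum_Suc: "int_sum f a (b + 1) = int_sum f a b + f (b + 1)"
proof -
  consider "a \<le> b" | "a = b + 1" | "b + 1 < a" by linarith
  then show ?thesis
  proof cases
    case 1
    then have "{a..b + 1} = insert (b + 1) {a..b}" by auto
    with 1 show ?thesis by (simp add: int_sum_def)
  next
    case 2
    then show ?thesis by (simp add: int_sum_def)
  next
    case 3
    then have "{b + 1..a - 1} = insert (b + 1) {b + 1 + 1..a - 1}" by auto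
    with 3 show ?thesis by (simp add: int_sum_def)
  qed
qed

text \<open>Induction on \<open>b\<close> in both directions from the empty sum at
  \<open>b = a - 1\<close>: the one-step recursion also runs backwards, so reversed limits need no
  separate case.\<close>

lemma int_sum_telescope:
  assumes "\<And>x. F (x + 1) = F x + f (x + 1)"
  shows "int_sum f a b = F b - F (a - 1)"
proof (induction b rule: int_induct[where k = "a - 1"])
  case base
  show ?case by (simp add: int_sum_def)
next
  case (step1 i)
  then show ?case using assms[of i] int_sum_Suc[of f a i] by simp
next
  case (step2 i)
  then show ?case using assms[of "i - 1"] int_sum_Suc[of f a "i - 1"] by simp
qed

lemma int_sum_diff: "int_sum (\<lambda>x. f x - h x) a b = int_sum f a b - int_sum h a b"
  by (simp add: int_sum_def sum_subtractf)

lemma int_sum_cmult: "int_sum (\<lambda>x. c * f x) a b = c * int_sum f a b"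
  by (simp add: int_sum_def sum_distrib_left)

lemma int_sum_split: "int_sum f a c = int_sum f a b + int_sum f (b + 1) c"
  using int_sum_telescope[of "int_sum f a" f "b + 1" c, OF int_sum_Suc] by simp

lemma int_sum_linear:
  "int_sum (\<lambda>x. of_int (c + e * x)) a b =
     of_int (c * (b - a + 1)) + of_int e / 2 * of_int ((b + a) * (b - a + 1))"
proof -
  define F :: "int \<Rightarrow> rat" where
    "F x = of_int c * of_int x + of_int e / 2 * (of_int x * (of_int x + 1))" for x
  have "F (x + 1) = F x + of_int (c + e * (x + 1))" for x
    by (simp add: F_def field_simps)
  then have "int_sum (\<lambda>x. of_int (c + e * x)) a b = F b - F (a - 1)"
    by (rule int_sum_telescope)
  then show ?thesis by (simp add: F_def field_simps)
qed

section \<open>Fractional part sums as sums of integer quotients\<close>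

lemma frac_sum_eq:
  assumes "n \<noteq> 0"
  shows "frac_sum s1 s2 c e n =
    int_sum (\<lambda>x. of_int (c + e * x)) s1 s2
    - of_int n * int_sum (\<lambda>x. of_int ((c + e * x) div n)) s1 s2"
proof -
  have "frac (of_int (c + e * x) / of_int n) * of_int n
      = (of_int (c + e * x) - of_int n * of_int ((c + e * x) div n) :: rat)" for x
    unfolding frac_mult_denominator_eq_mod[OF assms]
    by (simp flip: of_int_mult of_int_diff minus_mult_div_eq_mod)
  then show ?thesis
    by (simp only: frac_sum_def int_sum_diff int_sum_cmult)
qed

text \<open>Allows \<open>r4\<close> to be replaced by \<open>g1\<close>, its residue modulo
  \<open>r5\<close>, which puts the slope \<open>g1 / r5\<close> between 0 and 1.\<close>

lemma frac_sum_mod: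
  assumes "n \<noteq> 0"
  shows "frac_sum s1 s2 c (e mod n) n = frac_sum s1 s2 c e n"
proof -
  have "(c + e mod n * x) mod n = (c + e * x) mod n" for x
    by (metis mod_add_right_eq mod_mult_left_eq)
  then show ?thesis
    by (simp only: frac_sum_def frac_mult_denominator_eq_mod[OF assms])
qed

section \<open>Jumps of the quotient and reciprocity\<close>

text \<open>A step adds \<open>g < n\<close> to the numerator, so the quotient rises by at most 1.
  If it reaches \<open>y\<close>, then \<open>c + g * x < n * y \<le> c + g * (x + 1)\<close>, so
  \<open>(n * y - c) / g\<close> lies in the interval from \<open>x\<close> (excluded) to
  \<open>x + 1\<close> (included); its floor is \<open>x\<close> except at the right endpoint, the
  only point there where the division is exact.\<close>

lemma div_jump:
  fixes c g n x :: int
  assumes "0 < g" "g < n"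
  defines "y \<equiv> (c + g * x) div n + 1"
  shows "(c + g * (x + 1)) div n = y - 1 \<or>
    (c + g * (x + 1)) div n = y \<and> (n * y - c) div g = x + (if g dvd n * y - c then 1 else 0)"
proof (cases "n * y \<le> c + g * (x + 1)")
  case False
  define k where "k = (c + g * x) div n"
  have "n * k \<le> c + g * x"
    using assms by (simp add: k_def flip: minus_mod_eq_mult_div)
  then have "(c + g * (x + 1)) div n = k"
    using False assms
    by (intro int_div_pos_eq[where r = "c + g * (x + 1) - n * k"])
       (auto simp: algebra_simps y_def k_def)
  then show ?thesis by (simp add: y_def k_def)
next
  case True
  have upper: "c + g * x < n * y"
    using assms pos_mod_bound[of n "c + g * x"]
    by (simp add: y_def algebra_simps flip: minus_mod_eq_mult_div)
  have "(c + g * (x + 1)) div n = y"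
    using True upper assms
    by (intro int_div_pos_eq[where r = "c + g * (x + 1) - n * y"]) (auto simp: algebra_simps)
  moreover have "(n * y - c) div g = x + (if g dvd n * y - c then 1 else 0)"
  proof (cases "g dvd n * y - c")
    case True
    then obtain z where z: "n * y - c = g * z" by (elim dvdE)
    have "g * x < g * z" "g * z \<le> g * (x + 1)"
      using z upper \<open>n * y \<le> c + g * (x + 1)\<close> by linarith+
    then have "z = x + 1" using \<open>0 < g\<close> by simp
    then show ?thesis using True z \<open>0 < g\<close> by simp
  next
    case False
    then have "n * y - c \<noteq> g * (x + 1)" by (metis dvd_triv_left)
    then have "(n * y - c) div g = x"
      using upper True
      by (intro int_div_pos_eq[where r = "n * y - c - g * x"]) (auto simp: algebra_simps)
    then show ?thesis using False by simp
  qed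
  ultimately show ?thesis by simp
qed

text \<open>Negating \<open>c\<close>, \<open>g\<close> and \<open>n\<close> together changes
  neither the quotients nor the divisibility, which reduces a negative modulus to the positive
  case.\<close>

lemma div_jump_same_sign:
  fixes c g n x :: int
  assumes "0 < g \<and> g < n \<or> n < g \<and> g < 0"
  defines "y \<equiv> (c + g * x) div n + 1"
  shows "(c + g * (x + 1)) div n = y - 1 \<or>
    (c + g * (x + 1)) div n = y \<and> (n * y - c) div g = x + (if g dvd n * y - c then 1 else 0)"
  using assms(1)
proof
  assume "0 < g \<and> g < n"
  then show ?thesis unfolding y_def using div_jump by blast
next
  assume neg: "n < g \<and> g < 0"
  have num: "- c + - g * x = - (c + g * x)" "- c + - g * (x + 1) = - (c + g * (x + 1))"
    "- n * z - - c = - (n * z - c)" for z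
    by (simp_all add: algebra_simps)
  show ?thesis
    using div_jump[of "- g" "- n" "- c" x] neg
    unfolding num div_minus_minus minus_dvd_iff dvd_minus_iff y_def by simp
qed

lemma sum_div_reciprocity:
  fixes c g n :: int
  assumes "0 < g \<and> g < n \<or> n < g \<and> g < 0"
  defines "a \<equiv> \<lambda>x. (c + g * x) div n" and "b \<equiv> \<lambda>y. (n * y - c) div g"
  shows "int_sum (\<lambda>x. of_int (a x)) s t + int_sum (\<lambda>y. of_int (b y)) (a s + 1) (a t)
    = of_int (a s * (1 - s) + a t * t)
      + int_sum (\<lambda>y. if g dvd n * y - c then 1 else 0) (a s + 1) (a t)"
proof -
  define e :: "int \<Rightarrow> rat" where "e y = (if g dvd n * y - c then 1 else 0)" for y
  \<comment> \<open>With \<open>e\<close> subtracted, the summand at a jump from \<open>a x\<close>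
    to \<open>a x + 1\<close> is exactly \<open>x\<close>. The starting point 0 is arbitrary, since
    only differences of \<open>B\<close> occur.\<close>
  define B where "B = int_sum (\<lambda>y. of_int (b y) - e y) 0"
  have B_Suc: "B (y + 1) = B y + (of_int (b (y + 1)) - e (y + 1))" for y
    unfolding B_def by (rule int_sum_Suc)
  \<comment> \<open>A discrete antiderivative of \<open>a\<close>: without a jump
    \<open>a x * x\<close> grows by \<open>a (x + 1)\<close>; with a jump it grows by
    \<open>x\<close> more, and \<open>B\<close> removes this \<open>x\<close>.\<close>
  define G where "G x = of_int (a x * x) - B (a x)" for x
  have G_Suc: "G (x + 1) = G x + of_int (a (x + 1))" for x
  proof -
    have "a (x + 1) = a x \<or>
        a (x + 1) = a x + 1 \<and> of_int (b (a x + 1)) = of_int x + e (a x + 1)"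
      using div_jump_same_sign[OF assms(1), of c x] by (auto simp: a_def b_def e_def)
    then show ?thesis
      using B_Suc[of "a x"] by (auto simp: G_def algebra_simps)
  qed
  have "int_sum (\<lambda>x. of_int (a x)) s t = G t - G (s - 1)"
    by (intro int_sum_telescope G_Suc)
  \<comment> \<open>Moves the lower boundary from \<open>s - 1\<close> to \<open>s\<close>, so that
    only \<open>a s\<close> occurs; this produces the factor \<open>1 - s\<close>.\<close>
  moreover have "G s = G (s - 1) + of_int (a s)"
    using G_Suc[of "s - 1"] by simp
  moreover have "int_sum (\<lambda>y. of_int (b y) - e y) (a s + 1) (a t) = B (a t) - B (a s)"
    using int_sum_telescope[of B, OF B_Suc] by simp
  ultimately show ?thesis
    by (simp add: int_sum_diff G_def e_def algebra_simps)
qed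

section \<open>Counting a residue class in an interval\<close>

text \<open>Makes \<open>(x - k) div M\<close> an antiderivative of the indicator of the class of
  \<open>k\<close> modulo \<open>M\<close>, ready for telescoping.\<close>

lemma div_Suc_diff:
  fixes k M x :: int
  assumes "0 < M"
  shows "(x + 1 - k) div M = (x - k) div M + (if M dvd x + 1 - k then 1 else 0)"
proof (cases "M dvd x + 1 - k")
  case True
  then obtain z where z: "x + 1 - k = M * z" by (elim dvdE)
  then have "x - k = M * (z - 1) + (M - 1)" by (simp add: algebra_simps)
  then have "(x - k) div M = z - 1"
    using assms by (intro int_div_pos_eq[where r = "M - 1"]) auto
  with True z assms show ?thesis by simp
next
  case False
  define l where "l = (x - k) mod M"
  define z where "z = (x - k) div M"
  have eq: "x + 1 - k = M * z + (l + 1)" by (simp add: l_def z_def)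
  have "l + 1 \<noteq> M"
  proof
    assume "l + 1 = M"
    then have "x + 1 - k = M * (z + 1)" using eq by (simp add: distrib_left)
    with False show False by simp
  qed
  then have "l + 1 < M" "0 \<le> l"
    using pos_mod_bound[OF assms, of "x - k"] pos_mod_sign[OF assms, of "x - k"] unfolding l_def by linarith+
  then have "(x + 1 - k) div M = z" using eq by (intro int_div_pos_eq) auto
  with False show ?thesis by (simp add: z_def)
qed

text \<open>The first \<open>y \<ge> a + 1\<close> in the class of \<open>k\<close> is
  \<open>a + 1 + R\<close> with \<open>R = (k - (a + 1)) mod M\<close>, and further ones follow at
  distance \<open>M\<close>. The telescoped form keeps this valid for reversed limits.\<close>

lemma count_cong:
  fixes k M a b :: int
  assumes "0 < M"
  shows "int_sum (\<lambda>y. if M dvd y - k then 1 else 0) (a + 1) b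
    = of_int ((b - a - 1 - (k - (a + 1)) mod M) div M + 1)"
proof -
  define R where "R = (k - (a + 1)) mod M"
  define j where "j = (k - (a + 1)) div M"
  have R: "0 \<le> R" "R < M" using assms by (simp_all add: R_def)
  have k: "k = a + 1 + R + M * j" by (simp add: R_def j_def)
  have "int_sum (\<lambda>y. if M dvd y - k then 1 else 0) (a + 1) b
      = of_int ((b - k) div M) - of_int ((a - k) div M)"
    by (subst int_sum_telescope[where F = "\<lambda>y. of_int ((y - k) div M)"])
       (simp_all add: div_Suc_diff[OF assms])
  moreover have "(a - k) div M = - 1 - j"
    using R by (intro int_div_pos_eq[where r = "M - 1 - R"]) (simp_all add: k algebra_simps)
  moreover have "b - k = (b - a - 1 - R) + M * (- j)" by (simp add: k)
  then have "(b - k) div M = (b - a - 1 - R) div M - j"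
    using assms by (simp only: div_mult_self2)
  ultimately show ?thesis by (simp add: R_def)
qed

text \<open>Being invertible, \<open>u\<close> is coprime to \<open>M\<close>, so multiplication by
  \<open>u\<close> preserves and reflects divisibility by \<open>M\<close>, while it turns
  \<open>n * y\<close> into \<open>y\<close> modulo \<open>M\<close>.\<close>

lemma dvd_linear_iff_inverse:
  fixes M n t u y :: int
  assumes "[u * n = 1] (mod M)"
  shows "M dvd n * y - t \<longleftrightarrow> M dvd y - u * t"
proof -
  obtain j where j: "u * n = 1 + M * j"
    using assms by (metis cong_iff_lin cong_sym mult.commute)
  have "coprime n M" using assms by (metis coprime_iff_invertible_int mult.commute)
  then have "M dvd n * y - t \<longleftrightarrow> M dvd u * (n * y - t)"
    using assms
    by (metis coprime_commute coprime_dvd_mult_right_iff coprime_iff_invertible_int)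
  also have "u * (n * y - t) = (y - u * t) + M * (j * y)"
    by (simp add: right_diff_distrib j distrib_right flip: mult.assoc)
  also have "M dvd \<dots> \<longleftrightarrow> M dvd y - u * t" by (simp add: dvd_add_left_iff)
  finally show ?thesis .
qed

section \<open>Assembling the identity\<close>

theorem theorem2p2:
  fixes r1 r2 r3 r4 r5 g1 r1' r2' d q inv5 :: int and r A :: rat
  assumes r5_nonzero: "r5 \<noteq> 0"
    and g1: "of_int g1 = frac (of_int r4 / of_int r5 :: rat) * of_int r5"
    and g1_nonzero: "g1 \<noteq> 0"
    and r1': "r1' = \<lfloor>of_int (r3 + g1 * r1) / (of_int r5 :: rat)\<rfloor> + 2"
    and r2': "r2' = \<lfloor>of_int (r3 + g1 * r2) / (of_int r5 :: rat)\<rfloor> - 1"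
    and d: "d = signed_gcd r5 g1"
    and inv5: "[inv5 * (r5 div d) = 1] (mod (g1 div d))"
    and r: "r = frac ((of_int r3 / of_int d - of_int (r1' - 1) * (of_int r5 / of_int d)) * of_int inv5
                      / (of_int g1 / of_int d)) * (of_int g1 / of_int d)"
    and q: "q = (if d dvd r3
                 then \<lfloor>(of_int (r2' - r1' + 2) - r) / (of_int g1 / of_int d)\<rfloor> + 1
                 else 0)"
    and A: "A = of_int ((r2 - r1 + 1) * r3)
      + of_int g1 / 2 * of_int ((r2 + r1) * (r2 - r1 + 1))
      - of_int r5 *
        (- of_int \<lfloor>of_int ((r1' - 1) * r5 - r3) / (of_int g1 :: rat)\<rfloor>
         + of_int ((r1' - 2) * (- r1 + 1))
         + of_int q
         - of_int \<lfloor>of_int ((r2' + 1) * r5 - r3) / (of_int g1 :: rat)\<rfloor>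
         + of_int ((r2' + 1) * r2)
         + of_int r3 / of_int g1 * of_int (r2' - r1' + 1)
         - of_int r5 / (2 * of_int g1) * of_int ((r2' + r1') * (r2' - r1' + 1)))"
  shows "frac_sum r1 r2 r3 r4 r5
         + of_int r5 / of_int g1 * frac_sum r1' r2' (- r3) r5 g1 = A"
proof -
  have g_mod: "g1 = r4 mod r5"
    using g1 by (simp add: frac_mult_denominator_eq_mod[OF r5_nonzero])
  have sign: "0 < g1 \<and> g1 < r5 \<or> r5 < g1 \<and> g1 < 0"
    using g1_nonzero r5_nonzero pos_mod_bound[of r5 r4] pos_mod_sign[of r5 r4]
      neg_mod_bound[of r5 r4] neg_mod_sign[of r5 r4]
    unfolding g_mod by linarith
  define a where "a x = (r3 + g1 * x) div r5" for x
  define b where "b y = (r5 * y - r3) div g1" for y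
  \<comment> \<open>The offsets 2 and -1 mean that the second sum omits the first and last terms of
    the range from \<open>a r1 + 1\<close> to \<open>a r2\<close> given by reciprocity.\<close>
  have r1'_eq: "r1' = a r1 + 2" and r2'_eq: "r2' = a r2 - 1"
    by (simp_all only: r1' r2' floor_divide_of_int_eq a_def)

  have d_dvd: "d dvd r5" "d dvd g1" and "d \<noteq> 0"
    using r5_nonzero by (auto simp: d signed_gcd_def sgn_if)
  define M where "M = g1 div d"
  define n where "n = r5 div d"
  have g_eq: "g1 = d * M" and r5_eq: "r5 = d * n"
    using d_dvd by (simp_all add: M_def n_def)
  \<comment> \<open>\<open>d\<close> carries the sign of \<open>r5\<close>, which \<open>g1\<close>
    shares, so \<open>M\<close> is positive even when \<open>r5\<close> is negative, as
    \<open>count_cong\<close> requires.\<close>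
  have "sgn d = sgn g1"
    using sign by (auto simp: d signed_gcd_def sgn_mult)
  then have "M > 0"
    using sign unfolding g_eq by (auto simp: sgn_if zero_less_mult_iff mult_less_0_iff split: if_splits)
  have inv: "[inv5 * n = 1] (mod M)"
    using inv5 by (simp add: n_def M_def)

  have count: "int_sum (\<lambda>y. if g1 dvd r5 * y - r3 then 1 else 0) (a r1 + 1) (a r2) = of_int q"
  proof (cases "d dvd r3")
    case False
    \<comment> \<open>Since \<open>d\<close> divides both \<open>g1\<close> and \<open>r5\<close>,
      an exceptional \<open>y\<close> would force \<open>d dvd r3\<close>.\<close>
    then have "\<not> g1 dvd r5 * y - r3" for y
      using d_dvd by (meson dvd_diff_right_iff dvd_mult2 dvd_trans)
    then show ?thesis using False by (simp add: q int_sum_def)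
  next
    case True
    then obtain t where t: "r3 = d * t" by (elim dvdE)
    have quot: "of_int r3 / of_int d = (of_int t :: rat)"
      "of_int r5 / of_int d = (of_int n :: rat)" "of_int g1 / of_int d = (of_int M :: rat)"
      using \<open>d \<noteq> 0\<close> by (simp_all add: t g_eq r5_eq)
    have "r = of_int (((t - (r1' - 1) * n) * inv5) mod M)"
      using frac_mult_denominator_eq_mod[of M "(t - (r1' - 1) * n) * inv5"] \<open>M > 0\<close>
      unfolding r quot by simp
    \<comment> \<open>Here \<open>r1' - 1 = a r1 + 1\<close>, so \<open>r\<close> is the distance
      from the lower limit to the first exceptional \<open>y\<close>.\<close>
    also have "[(t - (r1' - 1) * n) * inv5 = inv5 * t - (a r1 + 1)] (mod M)"
    proof -
      have "[inv5 * t - (r1' - 1) * (inv5 * n) = inv5 * t - (r1' - 1) * 1] (mod M)"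
        by (intro cong_diff cong_mult cong_refl inv)
      then show ?thesis by (simp add: r1'_eq algebra_simps)
    qed
    then have "((t - (r1' - 1) * n) * inv5) mod M = (inv5 * t - (a r1 + 1)) mod M"
      by (simp add: cong_def)
    finally have r_eq: "r = of_int ((inv5 * t - (a r1 + 1)) mod M)" .
    have "q = \<lfloor>of_int (a r2 - a r1 - 1 - (inv5 * t - (a r1 + 1)) mod M) / (of_int M :: rat)\<rfloor> + 1"
      using True unfolding q r_eq quot by (simp add: r1'_eq r2'_eq)
    then have q_eq: "q = (a r2 - a r1 - 1 - (inv5 * t - (a r1 + 1)) mod M) div M + 1"
      by (simp only: floor_divide_of_int_eq)
    have "r5 * y - r3 = d * (n * y - t)" for y
      by (simp add: r5_eq t algebra_simps)
    then have "g1 dvd r5 * y - r3 \<longleftrightarrow> M dvd y - inv5 * t" for y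
      using \<open>d \<noteq> 0\<close> dvd_linear_iff_inverse[OF inv] by (simp add: g_eq)
    then show ?thesis
      by (simp only: count_cong[OF \<open>M > 0\<close>] q_eq)
  qed

  define Sa Sb :: rat where "Sa = int_sum (\<lambda>x. of_int (a x)) r1 r2"
    and "Sb = int_sum (\<lambda>y. of_int (b y)) r1' r2'"
  \<comment> \<open>The two omitted end terms are split off by the telescoping rules, so this also
    holds when the range has fewer than two elements or is reversed.\<close>
  have "int_sum (\<lambda>y. of_int (b y)) (a r1 + 1) (a r2) = of_int (b (a r1 + 1)) + Sb + of_int (b (a r2))"
    using int_sum_split[of "\<lambda>y. of_int (b y)" "a r1 + 1" "a r2" "a r1 + 1"]
      int_sum_Suc[of "\<lambda>y. of_int (b y)" "a r1 + 2" "a r2 - 1"]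
    by (simp add: Sb_def r1'_eq r2'_eq int_sum_def[of _ "a r1 + 1" "a r1 + 1"] add.assoc)
  then have core: "Sa + of_int (b (a r1 + 1)) + Sb + of_int (b (a r2))
      = of_int (a r1 * (1 - r1) + a r2 * r2) + of_int q"
    using sum_div_reciprocity[OF sign, of r3 r1 r2] count
    by (simp add: Sa_def a_def b_def)

  have S1: "frac_sum r1 r2 r3 r4 r5
      = of_int (r3 * (r2 - r1 + 1)) + of_int g1 / 2 * of_int ((r2 + r1) * (r2 - r1 + 1))
        - of_int r5 * Sa"
    using frac_sum_mod[OF r5_nonzero, of r1 r2 r3 r4] frac_sum_eq[OF r5_nonzero, of r1 r2 r3 g1]
    by (simp only: int_sum_linear Sa_def a_def g_mod)
  have S2: "frac_sum r1' r2' (- r3) r5 g1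
      = of_int (- r3 * (r2' - r1' + 1)) + of_int r5 / 2 * of_int ((r2' + r1') * (r2' - r1' + 1))
        - of_int g1 * Sb"
    using frac_sum_eq[OF g1_nonzero, of r1' r2' "- r3" r5]
    by (simp only: int_sum_linear Sb_def b_def) (simp add: algebra_simps)

  have floors: "\<lfloor>of_int ((r1' - 1) * r5 - r3) / (of_int g1 :: rat)\<rfloor> = b (a r1 + 1)"
    "\<lfloor>of_int ((r2' + 1) * r5 - r3) / (of_int g1 :: rat)\<rfloor> = b (a r2)"
    by (simp_all only: floor_divide_of_int_eq) (simp_all add: b_def r1'_eq r2'_eq mult.commute add.commute)
  \<comment> \<open>The factor \<open>r5 / g1\<close> turns \<open>g1 * Sb\<close> into
    \<open>r5 * Sb\<close>, so both sums of quotients enter only through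
    \<open>r5 * (Sa + Sb)\<close>; the other terms of \<open>A\<close> are the linear sums.\<close>
  have "- of_int (b (a r1 + 1)) + of_int ((r1' - 2) * (- r1 + 1)) + of_int q
      - of_int (b (a r2)) + of_int ((r2' + 1) * r2) = Sa + Sb"
    using core by (simp add: r1'_eq r2'_eq)
  then show ?thesis
    unfolding A floors S1 S2 using g1_nonzero by (simp add: field_simps)
qed

end
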